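(* Let $\mathcal{P}$ be the propositional system defined as follows. Its atomic formulas are the falsehood symbol $\bot$ and finitely many propositional variables $\phi_1,\ldots,\phi_n$; formulas are generated by the rule that if $A$ and $B$ are formulas then so are $A\wedge B$, $A\vee B$, $A\to B$ and $\Box A$ (and $\neg A$ abbreviates $A\to\bot$). The logical axioms and rules of $\mathcal{P}$ are those of minimal propositional calculus (with modus ponens), together with all instances of the axioms $$\Box(A\vee B)\leftrightarrow(\Box A\vee\Box B),\quad \Box(A\wedge B)\leftrightarrow(\Box A\wedge\Box B),\quad \Box(A\to B)\to(\Box A\to\Box B),\quad A\to\Box A,$$ and the deduction rule: from $\Box A$ infer $A$. The nonlogical axioms of $\mathcal{P}$ are $\phi_1\leftrightarrow A_1,\ \ldots,\ \phi_n\leftrightarrow A_n$, where each $A_i$ is an arbitrary formula in which every occurrence of every propositional variable lies within the scope of some $\Box$ operator. Then $\mathcal{P}$ is consistent, i.e. $\bot$ is not a theorem of $\mathcal{P}$.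
   Context: Minimal propositional calculus is intuitionistic propositional logic without the ex falso quodlibet law; $\bot$ is just an atomic formula with no special rules. *)

theory Defs
  imports Main
begin

datatype fm =
    Falsum                 ("\<^bold>\<bottom>")
  | Var nat
  | And fm fm              (infixr "\<^bold>\<and>" 65)
  | Or fm fm               (infixr "\<^bold>\<or>" 60)
  | Imp fm fm              (infixr "\<^bold>\<rightarrow>" 55)
  | Box fm                 ("\<^bold>\<box> _" [70] 70)

abbreviation Neg :: "fm \<Rightarrow> fm"  ("\<^bold>\<not> _" [70] 70)
  where "\<^bold>\<not> A \<equiv> A \<^bold>\<rightarrow> \<^bold>\<bottom>"

abbreviation Iff :: "fm \<Rightarrow> fm \<Rightarrow> fm"  (infix "\<^bold>\<leftrightarrow>" 50)
  where "A \<^bold>\<leftrightarrow> B \<equiv> (A \<^bold>\<rightarrow> B) \<^bold>\<and> (B \<^bold>\<rightarrow> A)"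

primrec vars :: "fm \<Rightarrow> nat set" where
  "vars \<^bold>\<bottom> = {}"
| "vars (Var i) = {i}"
| "vars (A \<^bold>\<and> B) = vars A \<union> vars B"
| "vars (A \<^bold>\<or> B) = vars A \<union> vars B"
| "vars (A \<^bold>\<rightarrow> B) = vars A \<union> vars B"
| "vars (\<^bold>\<box> A) = vars A"

text \<open>The formulas over the variables \<open>Var 1, \<dots>, Var n\<close>; the type \<open>fm\<close> itself has
  infinitely many variables.\<close>

definition language :: "nat \<Rightarrow> fm set" where
  "language n = {A. vars A \<subseteq> {1..n}}"

text \<open>Every occurrence of a variable lies within the scope of some box. Falsum is not a
  variable, so its occurrences are unrestricted.\<close>

primrec guarded :: "fm \<Rightarrow> bool" where
  "guarded \<^bold>\<bottom> \<longleftrightarrow> True"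
| "guarded (Var i) \<longleftrightarrow> False"
| "guarded (A \<^bold>\<and> B) \<longleftrightarrow> guarded A \<and> guarded B"
| "guarded (A \<^bold>\<or> B) \<longleftrightarrow> guarded A \<and> guarded B"
| "guarded (A \<^bold>\<rightarrow> B) \<longleftrightarrow> guarded A \<and> guarded B"
| "guarded (\<^bold>\<box> A) \<longleftrightarrow> True"

text \<open>A Hilbert-style axiomatisation (over modus ponens) of minimal propositional calculus:
  the usual intuitionistic axioms without ex falso quodlibet.\<close>

inductive minimal_axiom :: "fm \<Rightarrow> bool" where
  K: "minimal_axiom (A \<^bold>\<rightarrow> (B \<^bold>\<rightarrow> A))"
| S: "minimal_axiom ((A \<^bold>\<rightarrow> (B \<^bold>\<rightarrow> C)) \<^bold>\<rightarrow> ((A \<^bold>\<rightarrow> B) \<^bold>\<rightarrow> (A \<^bold>\<rightarrow> C)))"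
| conj_intro: "minimal_axiom (A \<^bold>\<rightarrow> (B \<^bold>\<rightarrow> (A \<^bold>\<and> B)))"
| conj_elim1: "minimal_axiom ((A \<^bold>\<and> B) \<^bold>\<rightarrow> A)"
| conj_elim2: "minimal_axiom ((A \<^bold>\<and> B) \<^bold>\<rightarrow> B)"
| disj_intro1: "minimal_axiom (A \<^bold>\<rightarrow> (A \<^bold>\<or> B))"
| disj_intro2: "minimal_axiom (B \<^bold>\<rightarrow> (A \<^bold>\<or> B))"
| disj_elim: "minimal_axiom ((A \<^bold>\<rightarrow> C) \<^bold>\<rightarrow> ((B \<^bold>\<rightarrow> C) \<^bold>\<rightarrow> ((A \<^bold>\<or> B) \<^bold>\<rightarrow> C)))"

inductive box_axiom :: "fm \<Rightarrow> bool" where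
  box_disj: "box_axiom ((\<^bold>\<box> (A \<^bold>\<or> B)) \<^bold>\<leftrightarrow> (\<^bold>\<box> A \<^bold>\<or> \<^bold>\<box> B))"
| box_conj: "box_axiom ((\<^bold>\<box> (A \<^bold>\<and> B)) \<^bold>\<leftrightarrow> (\<^bold>\<box> A \<^bold>\<and> \<^bold>\<box> B))"
| box_imp: "box_axiom (\<^bold>\<box> (A \<^bold>\<rightarrow> B) \<^bold>\<rightarrow> (\<^bold>\<box> A \<^bold>\<rightarrow> \<^bold>\<box> B))"
| box_intro: "box_axiom (A \<^bold>\<rightarrow> \<^bold>\<box> A)"

text \<open>\<open>provable n D A\<close>: \<open>A\<close> is a theorem of the system with variables \<open>Var 1, \<dots>, Var n\<close> and
  nonlogical axioms \<open>Var i \<^bold>\<leftrightarrow> D i\<close> for \<open>1 \<le> i \<le> n\<close>.  There are no hypotheses: \<open>box_elim\<close> is a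
  rule on theorems and does not yield the implication \<open>\<^bold>\<box> A \<^bold>\<rightarrow> A\<close>.\<close>

inductive provable :: "nat \<Rightarrow> (nat \<Rightarrow> fm) \<Rightarrow> fm \<Rightarrow> bool"
  for n :: nat and D :: "nat \<Rightarrow> fm" where
  minimal: "minimal_axiom A \<Longrightarrow> A \<in> language n \<Longrightarrow> provable n D A"
| box: "box_axiom A \<Longrightarrow> A \<in> language n \<Longrightarrow> provable n D A"
| nonlogical: "i \<in> {1..n} \<Longrightarrow> provable n D (Var i \<^bold>\<leftrightarrow> D i)"
| modus_ponens: "provable n D (A \<^bold>\<rightarrow> B) \<Longrightarrow> provable n D A \<Longrightarrow> provable n D B"
| box_elim: "provable n D (\<^bold>\<box> A) \<Longrightarrow> provable n D A"

definition consistent :: "nat \<Rightarrow> (nat \<Rightarrow> fm) \<Rightarrow> bool" where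
  "consistent n D \<longleftrightarrow> \<not> provable n D \<^bold>\<bottom>"

end

theory Submission imports Defs begin

text \<open>The system has a Kripke model on the natural numbers in which the successors of a world \<open>k\<close>
  are the worlds \<open>j \<le> k\<close>, and \<open>\<^bold>\<box> A\<close> holds at \<open>k\<close> when \<open>A\<close> holds at \<open>k - 1\<close>, vacuously so at
  \<open>k = 0\<close>. The truth value of a guarded formula at \<open>k\<close> depends only on those of the variables at
  earlier worlds, so the axioms \<open>\<phi>\<^sub>i \<leftrightarrow> A\<^sub>i\<close> can serve as a recursive definition of the variables.
  Persistence of truth makes \<open>A \<rightarrow> \<^bold>\<box> A\<close> valid, and the rule from \<open>\<^bold>\<box> A\<close> to \<open>A\<close> preserves
  validity since every world is the predecessor of another.\<close>

function forces :: "(nat \<Rightarrow> fm) \<Rightarrow> nat \<Rightarrow> fm \<Rightarrow> bool" where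
  "forces D k \<^bold>\<bottom> \<longleftrightarrow> False"
| "forces D k (Var i) \<longleftrightarrow> (if guarded (D i) then forces D k (D i) else False)"
| "forces D k (A \<^bold>\<and> B) \<longleftrightarrow> forces D k A \<and> forces D k B"
| "forces D k (A \<^bold>\<or> B) \<longleftrightarrow> forces D k A \<or> forces D k B"
| "forces D k (A \<^bold>\<rightarrow> B) \<longleftrightarrow> (\<forall>j. j \<le> k \<longrightarrow> forces D j A \<longrightarrow> forces D j B)"
| "forces D k (\<^bold>\<box> A) \<longleftrightarrow> (case k of 0 \<Rightarrow> True | Suc m \<Rightarrow> forces D m A)"
  by pat_completeness auto

text \<open>The middle component decreases when a variable is replaced by its guarded definition.\<close>

termination
  by (relation "(\<lambda>(D, k, A). k) <*mlex*>
    (\<lambda>(D, k, A). if guarded A then 0 else 1) <*mlex*>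
    measure (\<lambda>(D, k, A). size A)")
    (simp_all add: wf_mlex mlex_iff le_less)

text \<open>Induction follows the recursion of \<open>forces\<close>, since a variable unfolds to
  its definition, which is no subformula.\<close>

lemma forces_mono: "forces D k A \<Longrightarrow> j \<le> k \<Longrightarrow> forces D j A"
proof (induction D k A arbitrary: j rule: forces.induct)
  case (2 D k i)
  then show ?case by (simp split: if_splits)
next
  case (5 D k A B)
  from "5.prems" show ?case by simp
next
  case (6 D k A)
  then show ?case by (cases j; cases k) simp_all
qed auto

lemma forces_impI: "(\<And>j. j \<le> k \<Longrightarrow> forces D j A \<Longrightarrow> forces D j B) \<Longrightarrow> forces D k (A \<^bold>\<rightarrow> B)"
  by simp

lemma forces_impD: "forces D k (A \<^bold>\<rightarrow> B) \<Longrightarrow> j \<le> k \<Longrightarrow> forces D j A \<Longrightarrow> forces D j B"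
  by simp

lemma forces_iffI:
  assumes "\<And>j. forces D j A \<longleftrightarrow> forces D j B"
  shows "forces D k (A \<^bold>\<leftrightarrow> B)"
  using assms by simp

lemma forces_minimal_axiom:
  assumes "minimal_axiom A"
  shows "forces D k A"
  using assms
proof cases
  case (K A B)
  show ?thesis unfolding K by (intro forces_impI) (rule forces_mono)
next
  case (S A B C)
  have "forces D h C"
    if "forces D i (A \<^bold>\<rightarrow> B \<^bold>\<rightarrow> C)" "forces D j (A \<^bold>\<rightarrow> B)" "j \<le> i" "h \<le> j" "forces D h A" for i j h
  proof -
    have "forces D h (B \<^bold>\<rightarrow> C)"
      using that forces_impD[OF that(1), of h] by (blast intro: le_trans)
    moreover have "forces D h B"
      using forces_impD[OF that(2,4,5)] .
    ultimately show ?thesis by (rule forces_impD[OF _ order_refl])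
  qed
  then show ?thesis unfolding S by (intro forces_impI)
next
  case (conj_intro A B)
  then show ?thesis by (simp add: forces_mono)
qed simp_all

lemma forces_box_axiom:
  assumes "box_axiom A"
  shows "forces D k A"
  using assms
proof cases
  case (box_disj A B)
  have "forces D j (\<^bold>\<box> (A \<^bold>\<or> B)) \<longleftrightarrow> forces D j (\<^bold>\<box> A \<^bold>\<or> \<^bold>\<box> B)" for j
    by (cases j) simp_all
  then show ?thesis unfolding box_disj by (rule forces_iffI)
next
  case (box_conj A B)
  have "forces D j (\<^bold>\<box> (A \<^bold>\<and> B)) \<longleftrightarrow> forces D j (\<^bold>\<box> A \<^bold>\<and> \<^bold>\<box> B)" for j
    by (cases j) simp_all
  then show ?thesis unfolding box_conj by (rule forces_iffI)
next
  case (box_imp A B)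
  have "forces D i (\<^bold>\<box> B)"
    if "forces D j (\<^bold>\<box> (A \<^bold>\<rightarrow> B))" "i \<le> j" "forces D i (\<^bold>\<box> A)" for i j
    using that by (cases i; cases j) simp_all
  then show ?thesis unfolding box_imp by (intro forces_impI)
next
  case (box_intro A)
  have "forces D j (\<^bold>\<box> A)" if "forces D j A" for j
    \<comment> \<open>At \<open>j = 0\<close> the box holds vacuously; otherwise
      \<open>j - 1\<close> is the world it refers to.\<close>
    using forces_mono[OF that, of "j - 1"] by (cases j) simp_all
  then show ?thesis unfolding box_intro by (intro forces_impI)
qed

lemma forces_provable:
  assumes "provable n D A" and "\<And>i. i \<in> {1..n} \<Longrightarrow> guarded (D i)"
  shows "forces D k A"
  using assms(1)
\<comment> \<open>\<open>k\<close> is generalised because \<open>box_elim\<close> uses its premise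
  one world up.\<close>
proof (induction arbitrary: k)
  case (minimal A)
  then show ?case by (intro forces_minimal_axiom)
next
  case (box A)
  then show ?case by (intro forces_box_axiom)
next
  case (nonlogical i)
  then have "guarded (D i)" by (rule assms(2))
  \<comment> \<open>The test in \<open>forces\<close> succeeds, so \<open>Var i\<close> takes the
    value of \<open>D i\<close>, not the dummy \<open>False\<close>.\<close>
  then show ?case by (intro forces_iffI) simp
next
  case (modus_ponens A B)
  show ?case by (rule forces_impD[OF modus_ponens.IH(1) order_refl modus_ponens.IH(2)])
next
  case (box_elim A)
  from box_elim.IH[of "Suc k"] show ?case by simp
qed

theorem theorem6p1:
  fixes n :: nat and A :: "nat \<Rightarrow> fm"
  assumes "\<And>i. i \<in> {1..n} \<Longrightarrow> A i \<in> language n"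
    and "\<And>i. i \<in> {1..n} \<Longrightarrow> guarded (A i)"
  shows "consistent n A"
  unfolding consistent_def
proof
  assume "provable n A \<^bold>\<bottom>"
  from forces_provable[OF this assms(2), of 0] show False by simp
qed

end
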